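(* Let $\lambda>0$. For $k\in\mathbb{N}_0=\{0,1,2,\dots\}$ and $t\ge 0$ put $$p(k,t)=\frac{1}{k!}\sum_{j=1}^{k+1}(-1)^{k+1-j}\,j^{k}\binom{k+1}{j}\,e^{-\frac{\lambda t}{j}}.$$ Then $(p(k,\cdot))_{k\ge 0}$ is the solution of the system $$\begin{cases} p'(0,t)=-\lambda\, p(0,t),\\[2pt] p'(k,t)=\dfrac{\lambda}{k}\,p(k-1,t)-\dfrac{\lambda}{1+k}\,p(k,t), & k\ge 1,\end{cases}$$ with initial conditions $p(k,0)=\delta_{k,0}$ for all $k\ge 0$.
   Context: The prime denotes the derivative with respect to $t$, and $\delta_{k,0}$ is the Kronecker delta. The system is the forward equation of the pure birth process on $\mathbb{N}_0$ started at $0$ with birth rate $\lambda_k=\lambda/(1+k)$ in state $k$, and $p(k,t)$ is the probability of being in state $k$ at time $t$. *)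

theory Defs
  imports Complex_Main
begin

definition p :: "real \<Rightarrow> nat \<Rightarrow> real \<Rightarrow> real" where
  "p lam k t = 1 / fact k *
     (\<Sum>j = 1..k + 1. (- 1) ^ (k + 1 - j) * real j ^ k * real ((k + 1) choose j) * exp (- (lam * t / real j)))"

text \<open>The time domain is the closed half-line, so the derivative at \<open>t = 0\<close> is one-sided.
  Values of \<open>q k t\<close> for negative \<open>t\<close> are irrelevant.\<close>

definition solves_birth_system :: "real \<Rightarrow> (nat \<Rightarrow> real \<Rightarrow> real) \<Rightarrow> bool" where
  "solves_birth_system lam q \<longleftrightarrow>
     (\<forall>t\<ge>0. (q 0 has_real_derivative - lam * q 0 t) (at t within {0..})) \<and>
     (\<forall>k\<ge>1. \<forall>t\<ge>0. (q k has_real_derivative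
         lam / real k * q (k - 1) t - lam / (1 + real k) * q k t) (at t within {0..})) \<and>
     (\<forall>k. q k 0 = (if k = 0 then 1 else 0))"

end

theory Submission
  imports Defs "HOL-Analysis.Derivative"
begin

text \<open>The initial values vanish for \<open>k \<ge> 1\<close> because \<open>p lam k 0\<close> is a multiple of the
  \<open>(k + 1)\<close>-st finite difference of the monomial \<open>x ^ k\<close>. The differential equations hold
  separately for the coefficient of each exponential, by absorption of binomial coefficients.
  For uniqueness, the difference of two solutions satisfies, by induction on \<open>k\<close>, the
  homogeneous equation \<open>f' = - c * f\<close> with \<open>f 0 = 0\<close>, so \<open>f t * exp (c * t)\<close> is constant.\<close>

text \<open>Induction on \<open>m\<close>: split one factor \<open>of_nat j + a\<close> into
  \<open>a\<close> and \<open>of_nat j\<close>. The first part has a lower exponent. In the second,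
  absorption lowers \<open>n\<close> by one, and reindexing moves the shift from \<open>a\<close> to
  \<open>1 + a\<close>; the shift is there so that the induction hypothesis covers this.\<close>

lemma alternating_binomial_sum_power_eq_0:
  fixes a :: "'a::comm_ring_1"
  assumes "m < n"
  shows "(\<Sum>j\<le>n. (- 1) ^ j * of_nat (n choose j) * (of_nat j + a) ^ m) = 0"
  using assms
proof (induction m arbitrary: n a)
  case 0
  then show ?case
    using choose_alternating_sum[of n, where 'a = 'a] by simp
next
  case (Suc m)
  then obtain n' where n: "n = Suc n'" and "m < n'"
    by (cases n) auto
  have absorb: "of_nat (Suc j) * of_nat (n choose Suc j) = (of_nat n * of_nat (n' choose j) :: 'a)" for j
    unfolding n of_nat_mult [symmetric] by (simp only: Suc_times_binomial)
  have "(\<Sum>j\<le>n. (- 1) ^ j * of_nat (n choose j) * (of_nat j + a) ^ Suc m) =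
      a * (\<Sum>j\<le>n. (- 1) ^ j * of_nat (n choose j) * (of_nat j + a) ^ m) +
      (\<Sum>j\<le>n. (- 1) ^ j * (of_nat j * of_nat (n choose j)) * (of_nat j + a) ^ m)"
    by (simp add: sum_distrib_left flip: sum.distrib) (simp add: algebra_simps)
  also have "(\<Sum>j\<le>n. (- 1) ^ j * of_nat (n choose j) * (of_nat j + a) ^ m) = 0"
    using Suc.prems by (intro Suc.IH) simp
  also have "(\<Sum>j\<le>n. (- 1) ^ j * (of_nat j * of_nat (n choose j)) * (of_nat j + a) ^ m) =
      (\<Sum>j\<le>n'. (- 1) ^ Suc j * (of_nat (Suc j) * of_nat (n choose Suc j)) * (of_nat (Suc j) + a) ^ m)"
    unfolding n sum.atMost_Suc_shift by simp
  also have "\<dots> = - of_nat n * (\<Sum>j\<le>n'. (- 1) ^ j * of_nat (n' choose j) * (of_nat j + (1 + a)) ^ m)"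
    unfolding absorb by (simp add: sum_distrib_left algebra_simps)
  also have "(\<Sum>j\<le>n'. (- 1) ^ j * of_nat (n' choose j) * (of_nat j + (1 + a)) ^ m) = 0"
    using \<open>m < n'\<close> by (rule Suc.IH)
  finally show ?case by simp
qed

lemma p_at_0: "p lam k 0 = (if k = 0 then 1 else 0)"
proof (cases "k = 0")
  case True
  then show ?thesis by (simp add: p_def)
next
  case False
  \<comment> \<open>The added summand at \<open>j = 0\<close> vanishes only because
    \<open>k > 0\<close>; for \<open>k = 0\<close> it would contain
    \<open>0 ^ 0 = 1\<close>.\<close>
  have "(\<Sum>j = 1..k + 1. (- 1) ^ (k + 1 - j) * real j ^ k * real ((k + 1) choose j)) =
      (\<Sum>j\<le>k + 1. (- 1) ^ (k + 1 - j) * real j ^ k * real ((k + 1) choose j))"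
    using False by (intro sum.mono_neutral_left) auto
  also have "\<dots> = (\<Sum>j\<le>k + 1. (- 1) ^ (k + 1) *
      ((- 1) ^ j * real ((k + 1) choose j) * (real j + 0) ^ k))"
    by (intro sum.cong refl) (auto simp: minus_one_power_iff)
  also have "\<dots> = 0"
    unfolding sum_distrib_left [symmetric]
    by (subst alternating_binomial_sum_power_eq_0) auto
  finally show ?thesis
    using False by (simp add: p_def)
qed

lemma p_0_has_derivative:
  "(p lam 0 has_real_derivative - lam * p lam 0 t) (at t within S)"
  unfolding p_def by (auto intro!: derivative_eq_intros)

lemma p_Suc_has_derivative:
  "(p lam (Suc m) has_real_derivative
     lam / real (Suc m) * p lam m t - lam / (1 + real (Suc m)) * p lam (Suc m) t) (at t within S)"
proof -
  define c where "c k j = (- 1) ^ (k + 1 - j) * real j ^ k * real ((k + 1) choose j)" for k j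
  define e where "e t j = exp (- (lam / real j) * t)" for t j
  have p_eq: "p lam k t = 1 / fact k * (\<Sum>j = 1..k + 1. c k j * e t j)" for k t
    unfolding p_def c_def e_def by simp
  have p_Suc_eq: "p lam (Suc m) t = 1 / fact (Suc m) * (\<Sum>j = 1..m + 2. c (Suc m) j * e t j)" for t
  proof -
    have "Suc m + 1 = m + 2" by simp
    then show ?thesis unfolding p_eq by (simp only:)
  qed
  have deriv: "(p lam (Suc m) has_real_derivative
      1 / fact (Suc m) * (\<Sum>j = 1..m + 2. c (Suc m) j * (e t j * - (lam / real j)))) (at t within S)"
  proof -
    have "((\<lambda>t. exp (a * t)) has_real_derivative exp (a * t) * a) (at t within S)" for a :: real
      by (auto intro!: derivative_eq_intros)
    then have "((\<lambda>t. e t j) has_real_derivative e t j * - (lam / real j)) (at t within S)" for j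
      unfolding e_def .
    then show ?thesis
      unfolding p_Suc_eq by (intro DERIV_cmult DERIV_sum)
  qed
  \<comment> \<open>This is what the equation says about the coefficient of \<open>e t j\<close>,
    with \<open>lam\<close> and the factorials divided out.\<close>
  have coeff: "c (Suc m) j * (1 / (real m + 2) - 1 / real j) = c m j" if j: "j \<in> {1..m + 2}" for j
  proof (cases "j = m + 2")
    \<comment> \<open>Both sides are zero: the bracket on the left and the binomial coefficient
      \<open>(m + 1) choose (m + 2)\<close> on the right.\<close>
    case True
    then show ?thesis by (simp add: c_def binomial_eq_0 add.commute)
  next
    case False
    with j have "j \<le> m + 1" "j > 0" by auto
    \<comment> \<open>Writing \<open>d\<close> for \<open>m + 1 - j\<close> removes truncated
      subtraction. The bracket equals \<open>- (d + 1) / ((m + 2) * j)\<close>: its sign turns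
      \<open>(- 1) ^ Suc d\<close> into \<open>(- 1) ^ d\<close>, its \<open>j\<close> lowers the
      power of \<open>j\<close>, and the rest is absorbed by the binomial coefficient.\<close>
    then obtain d where d: "m + 1 = j + d" using le_Suc_ex by blast
    have d': "m + 2 - j = Suc d" "m + 1 - j = d" using d by simp_all
    have "Suc d * ((m + 2) choose j) = (m + 2) * ((m + 1) choose j)"
      using binomial_absorb_comp[of "m + 2" j] d' by simp
    then have "(1 + real d) * real ((m + 2) choose j) = (real m + 2) * real ((m + 1) choose j)"
      by (metis of_nat_Suc of_nat_add of_nat_mult of_nat_numeral)
    then have absorb: "real ((m + 2) choose j) * (1 + real d) / (real m + 2) = real ((m + 1) choose j)"
      by (simp add: field_simps)
    have m: "real m + 2 = real j + real d + 1" using d by linarith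
    have "c (Suc m) j = - ((- 1) ^ d * real j ^ m * real j * real ((m + 2) choose j))"
      using d' by (simp add: c_def)
    moreover have "1 / (real m + 2) - 1 / real j = - ((1 + real d) / (real m + 2) / real j)"
      using \<open>j > 0\<close> unfolding m by (simp add: field_simps) (simp add: minus_divide_left del: divide_minus_left)
    ultimately have "c (Suc m) j * (1 / (real m + 2) - 1 / real j) =
        (- 1) ^ d * real j ^ m * (real ((m + 2) choose j) * (1 + real d) / (real m + 2))"
      using \<open>j > 0\<close> by simp
    also have "\<dots> = c m j" unfolding absorb c_def d' ..
    finally show ?thesis .
  qed
  \<comment> \<open>Split \<open>- lam / j\<close> as
    \<open>lam * (1 / (m + 2) - 1 / j) - lam / (m + 2)\<close>: the first term yields
    \<open>p lam m\<close>, the second the decay term.\<close>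
  have "(\<Sum>j = 1..m + 2. c (Suc m) j * (e t j * - (lam / real j))) =
      (\<Sum>j = 1..m + 2. lam * (c (Suc m) j * (1 / (real m + 2) - 1 / real j) * e t j)
        - lam / (real m + 2) * (c (Suc m) j * e t j))"
    by (intro sum.cong refl) (simp add: algebra_simps)
  also have "\<dots> = lam * (\<Sum>j = 1..m + 2. c (Suc m) j * (1 / (real m + 2) - 1 / real j) * e t j)
      - lam / (real m + 2) * (\<Sum>j = 1..m + 2. c (Suc m) j * e t j)"
    by (simp only: sum_subtractf sum_distrib_left)
  also have "(\<Sum>j = 1..m + 2. c (Suc m) j * (1 / (real m + 2) - 1 / real j) * e t j) =
      (\<Sum>j = 1..m + 2. c m j * e t j)"
    by (intro sum.cong refl arg_cong2[of _ _ _ _ "(*)"] coeff)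
  also have "\<dots> = (\<Sum>j = 1..m + 1. c m j * e t j)"
    by (intro sum.mono_neutral_right) (auto simp: c_def binomial_eq_0)
  finally have "1 / fact (Suc m) * (\<Sum>j = 1..m + 2. c (Suc m) j * (e t j * - (lam / real j))) =
      lam / real (Suc m) * (1 / fact m * (\<Sum>j = 1..m + 1. c m j * e t j)) -
      lam / (1 + real (Suc m)) * (1 / fact (Suc m) * (\<Sum>j = 1..m + 2. c (Suc m) j * e t j))"
    by (simp only: right_diff_distrib) (simp add: add.commute del: sum.cl_ivl_Suc)
  then show ?thesis using deriv unfolding p_eq[of m] p_Suc_eq by (simp only:)
qed

lemma linear_ode_zero_unique:
  fixes f :: "real \<Rightarrow> real"
  assumes deriv: "\<And>t. t \<ge> 0 \<Longrightarrow> (f has_real_derivative - c * f t) (at t within {0..})"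
    and "f 0 = 0" and "t \<ge> 0"
  shows "f t = 0"
proof -
  have "((\<lambda>t. f t * exp (c * t)) has_real_derivative 0) (at t within {0..})" if "t \<in> {0..}" for t
  proof -
    have "((\<lambda>t. exp (c * t)) has_real_derivative exp (c * t) * c) (at t within {0..})"
      by (auto intro!: derivative_eq_intros)
    from DERIV_mult[OF deriv this] that show ?thesis by simp
  qed
  \<comment> \<open>A zero derivative within a convex set forces constancy, so the one-sided
    derivative at 0 suffices.\<close>
  then have "\<exists>a. \<forall>t\<in>{0..}. f t * exp (c * t) = a"
    by (intro has_field_derivative_zero_constant convex_real_interval(1))
  then obtain a where a: "\<And>t. t \<ge> 0 \<Longrightarrow> f t * exp (c * t) = a"
    by auto
  from a[of 0] a[of t] assms(2,3) show ?thesis by simp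
qed

lemma solves_birth_system_p: "solves_birth_system lam (p lam)"
  unfolding solves_birth_system_def
proof (intro conjI allI impI)
  fix k :: nat and t :: real
  assume "1 \<le> k"
  then show "(p lam k has_real_derivative
      lam / real k * p lam (k - 1) t - lam / (1 + real k) * p lam k t) (at t within {0..})"
    using p_Suc_has_derivative[of lam "k - 1" t] by simp
qed (rule p_0_has_derivative p_at_0)+

lemma solves_birth_system_unique:
  assumes q: "solves_birth_system lam q" and r: "solves_birth_system lam r" and "t \<ge> 0"
  shows "q k t = r k t"
  using \<open>t \<ge> 0\<close>
\<comment> \<open>The equation for the next difference is needed on the whole half-line, hence the
  induction hypothesis at every time.\<close>
proof (induction k arbitrary: t)
  case 0
  have "q 0 t - r 0 t = 0"
  proof (rule linear_ode_zero_unique[where c = lam and f = "\<lambda>t. q 0 t - r 0 t"])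
    fix t :: real
    assume "t \<ge> 0"
    with q r have "(q 0 has_real_derivative - lam * q 0 t) (at t within {0..})"
      "(r 0 has_real_derivative - lam * r 0 t) (at t within {0..})"
      by (auto simp: solves_birth_system_def)
    from DERIV_diff[OF this]
    show "((\<lambda>t. q 0 t - r 0 t) has_real_derivative - lam * (q 0 t - r 0 t)) (at t within {0..})"
      by (simp add: algebra_simps)
  qed (use q r 0 in \<open>auto simp: solves_birth_system_def\<close>)
  then show ?case by simp
next
  case (Suc k)
  have deriv: "(s (Suc k) has_real_derivative
      lam / real (Suc k) * s k t - lam / (1 + real (Suc k)) * s (Suc k) t) (at t within {0..})"
    if "solves_birth_system lam s" "t \<ge> 0" for s t
    using that unfolding solves_birth_system_def by force
  have "q (Suc k) t - r (Suc k) t = 0"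
  proof (rule linear_ode_zero_unique[where c = "lam / (1 + real (Suc k))"
        and f = "\<lambda>t. q (Suc k) t - r (Suc k) t"])
    fix t :: real
    assume "t \<ge> 0"
    \<comment> \<open>The inflow terms from state \<open>k\<close> cancel by the induction
      hypothesis, leaving a homogeneous equation.\<close>
    from DERIV_diff[OF deriv[OF q this] deriv[OF r this]] Suc.IH[OF this]
    show "((\<lambda>t. q (Suc k) t - r (Suc k) t) has_real_derivative
        - (lam / (1 + real (Suc k))) * (q (Suc k) t - r (Suc k) t)) (at t within {0..})"
      by (simp add: algebra_simps)
  qed (use q r Suc.prems in \<open>auto simp: solves_birth_system_def\<close>)
  then show ?case by simp
qed

theorem proposition1:
  fixes lam :: real
  assumes "lam > 0"
  shows "solves_birth_system lam (p lam) \<and>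
    (\<forall>q. solves_birth_system lam q \<longrightarrow> (\<forall>k. \<forall>t\<ge>0. q k t = p lam k t))"
  using solves_birth_system_p solves_birth_system_unique by blast

end
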